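(* If $B$ is an $\infty$-type bicyclic graph and $B$ is unimodular, then $B$ has exactly one perfect matching.
   Context: All graphs are finite, undirected and simple. A connected graph $B$ is bicyclic if $|E(B)|=|V(B)|+1$. A bicyclic graph is called $\infty$-type if its cycles are edge-disjoint (it then has exactly two cycles, sharing at most one vertex). $A(B)$ denotes the $0$-$1$ adjacency matrix of $B$; $B$ is unimodular if $\det A(B)\in\{-1,1\}$. A perfect matching is a spanning subgraph each of whose components is a $K_2$. *)

theory Defs
  imports
    "Graph_Theory.Digraph_Component"
    "Graph_Theory.Kuratowski"
    "Jordan_Normal_Form.Determinant"
begin

text \<open>
  A finite simple graph is a \<^locale>\<open>pair_graph\<close>: a finite, loopless, symmetric digraph
  whose arcs are pairs of vertices.  Each undirected edge \<open>{u, v}\<close> is represented by the two arcs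
  \<open>(u, v)\<close> and \<open>(v, u)\<close>, so edges are counted and compared as two-element sets.
\<close>

definition uedge :: "'a \<times> 'a \<Rightarrow> 'a set" where
  "uedge e = {fst e, snd e}"

definition uedges :: "'a pair_pre_digraph \<Rightarrow> 'a set set" where
  "uedges G = uedge ` parcs G"

definition bicyclic :: "'a pair_pre_digraph \<Rightarrow> bool" where
  "bicyclic G \<longleftrightarrow> connected (with_proj G) \<and> card (uedges G) = card (pverts G) + 1"

text \<open>
  In a symmetric digraph the closed walk \<open>a, b, a\<close> along a single edge satisfies
  \<^const>\<open>pre_digraph.cycle\<close>; the length bound excludes it.  A cycle of the undirected graph is
  identified with its edge set, since traversals of one cycle from different starting points or
  in different directions are different arc lists.
\<close>

definition ucycle :: "'a pair_pre_digraph \<Rightarrow> ('a \<times> 'a) awalk \<Rightarrow> bool" where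
  "ucycle G p \<longleftrightarrow> pre_digraph.cycle (with_proj G) p \<and> 3 \<le> length p"

definition cycles :: "'a pair_pre_digraph \<Rightarrow> 'a set set set" where
  "cycles G = {uedge ` set p | p. ucycle G p}"

definition infinity_bicyclic :: "'a pair_pre_digraph \<Rightarrow> bool" where
  "infinity_bicyclic G \<longleftrightarrow>
     bicyclic G \<and> (\<forall>C \<in> cycles G. \<forall>D \<in> cycles G. C \<noteq> D \<longrightarrow> C \<inter> D = {})"

definition adjacency_mat :: "'a pair_pre_digraph \<Rightarrow> 'a list \<Rightarrow> int mat" where
  "adjacency_mat G vs =
     mat (length vs) (length vs) (\<lambda>(i, j). if (vs ! i, vs ! j) \<in> parcs G then 1 else 0)"

definition enumerates :: "'a list \<Rightarrow> 'a set \<Rightarrow> bool" where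
  "enumerates vs V \<longleftrightarrow> distinct vs \<and> set vs = V"

text \<open>
  The determinant does not depend on the enumeration of the vertices; see
  \<open>unimodular_iff\<close> below.
\<close>

definition unimodular :: "'a pair_pre_digraph \<Rightarrow> bool" where
  "unimodular G \<longleftrightarrow>
     (\<exists>vs. enumerates vs (pverts G) \<and> det (adjacency_mat G vs) \<in> {-1, 1})"

text \<open>
  For the symmetric digraph \<open>M\<close>, strongly connected components are the connected components.
\<close>

definition perfect_matching :: "'a pair_pre_digraph \<Rightarrow> 'a pair_pre_digraph \<Rightarrow> bool" where
  "perfect_matching M G \<longleftrightarrow>
     pair_graph M \<and> spanning (with_proj M) (with_proj G) \<and>
     (\<forall>C \<in> pre_digraph.sccs (with_proj M). K\<^bsub>2\<^esub> C)"

lemma det_adjacency_mat_eq: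
  assumes "enumerates vs V" "enumerates ws V"
  shows "det (adjacency_mat G vs) = det (adjacency_mat G ws)"
proof -
  define n where "n = length ws"
  have "mset vs = mset ws"
    using assms unfolding enumerates_def by (metis set_eq_iff_mset_eq_distinct)
  then obtain p where p: "p permutes {..<length ws}" "permute_list p ws = vs"
    by (rule mset_eq_permutation)
  have len: "length vs = n" using p(2) by (auto simp: n_def)
  have pn: "p permutes {0..<n}" using p(1) by (simp add: n_def atLeast0LessThan)
  have pl: "p i < n" if "i < n" for i
    using permutes_in_image[OF pn, of i] that by simp
  have nth: "vs ! i = ws ! p i" if "i < n" for i
    using p that permute_list_nth[OF p(1), of i] by (simp add: n_def)
  let ?A = "adjacency_mat G ws"
  have A: "?A \<in> carrier_mat n n" by (simp add: adjacency_mat_def n_def)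
  let ?B = "mat n n (\<lambda>(i, j). ?A $$ (p i, j))"
  have B: "transpose_mat ?B \<in> carrier_mat n n" by simp
  have "transpose_mat (adjacency_mat G vs)
      = mat n n (\<lambda>(i, j). transpose_mat ?B $$ (p i, j))"
    by (rule eq_matI) (auto simp: adjacency_mat_def len nth pl n_def[symmetric])
  then have "det (transpose_mat (adjacency_mat G vs)) = signof p * det (transpose_mat ?B)"
    using det_permute_rows[OF B pn] by simp
  also have "det (transpose_mat ?B) = signof p * det ?A"
    using det_permute_rows[OF A pn] det_transpose[of ?B n] by simp
  also have "signof p * (signof p * det ?A) = det ?A"
    by (simp add: sign_def)
  finally show ?thesis
    using det_transpose[of "adjacency_mat G vs" n] by (simp add: adjacency_mat_def len)
qed

lemma unimodular_iff:
  assumes "enumerates vs (pverts G)"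
  shows "unimodular G \<longleftrightarrow> det (adjacency_mat G vs) \<in> {-1, 1}"
  using assms det_adjacency_mat_eq[OF assms] unfolding unimodular_def by metis

end

theory Submission
  imports Defs
begin

text \<open>
  Perfect matchings are counted modulo 2.  In the Leibniz expansion of the determinant the signs
  disappear modulo 2, so a unimodular graph has an odd number of permutations \<open>p\<close> of its vertices that send every
  vertex to a neighbour.  Inversion acts on these permutations, and its fixed points are the
  involutions that send every vertex to a neighbour, that is, the perfect matchings.  Hence
  their number is odd (\<open>odd_card_matching_involutions\<close>), and a perfect matching exists.

  Suppose that there were two, \<open>\<sigma>\<close> and \<open>\<tau>\<close>.  Through a vertex where they differ
  passes a cycle whose edges belong alternately to \<open>\<sigma>\<close> and \<open>\<tau>\<close> (\<open>alternating_cycle\<close>); let \<open>W\<close>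
  be its vertex set.  Every perfect matching \<open>\<rho>\<close> coincides on \<open>W\<close> with \<open>\<sigma>\<close> or with \<open>\<tau>\<close>
  (\<open>matching_involution_agrees_on_cycle\<close>): if it differs from \<open>\<sigma>\<close> there, some edge of \<open>\<sigma>\<close> on
  this cycle is not in \<open>\<rho>\<close>, and it lies also on a cycle that alternates between \<open>\<rho>\<close> and \<open>\<sigma>\<close>.  Distinct cycles have
  no common edge, so both cycles are the same, which forces \<open>\<rho> = \<tau>\<close> on \<open>W\<close>.  Therefore
  exchanging \<open>\<sigma>\<close> and \<open>\<tau>\<close> on \<open>W\<close> pairs off the perfect matchings, and their number is even
  (\<open>even_card_matching_involutions\<close>), a contradiction.
\<close>

section \<open>The determinant modulo 2\<close>

lemma even_card_iff_even_card_fixpoints: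
  assumes "finite S" "\<And>x. x \<in> S \<Longrightarrow> g x \<in> S" "\<And>x. x \<in> S \<Longrightarrow> g (g x) = x"
  shows "even (card S) \<longleftrightarrow> even (card {x \<in> S. g x = x})"
  using assms
proof (induction S rule: finite_psubset_induct)
  case (psubset S)
  show ?case
  proof (cases "\<exists>x\<in>S. g x \<noteq> x")
    case False
    then have "{x \<in> S. g x = x} = S" by auto
    then show ?thesis by simp
  next
    case True
    then obtain x where x: "x \<in> S" "g x \<noteq> x" by blast
    let ?T = "S - {x, g x}"
    have gx: "g x \<in> S" "g (g x) = x" using psubset.prems x(1) by auto
    have "even (card ?T) \<longleftrightarrow> even (card {y \<in> ?T. g y = y})"
    proof (rule psubset.IH)
      show "?T \<subset> S" using x(1) by blast
      fix y assume y: "y \<in> ?T"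
      then show "g (g y) = y" using psubset.prems by simp
      show "g y \<in> ?T"
        using y psubset.prems(1)[of y] psubset.prems(2)[of y] gx by auto
    qed
    moreover have "{y \<in> ?T. g y = y} = {y \<in> S. g y = y}"
      using x gx by auto
    moreover have "card ?T = card S - 2"
      using x gx by (subst card_Diff_subset) auto
    moreover have "2 \<le> card S"
      using card_mono[OF psubset.hyps(1), of "{x, g x}"] x gx by simp
    ultimately show ?thesis by simp
  qed
qed

text \<open>
  Modulo 2 the summand of a permutation in the Leibniz expansion is 1 if the permutation follows
  edges, and 0 otherwise.  The determinant permutes indices, so what remains is to carry the count
  over to permutations of the vertices themselves.
\<close>
lemma odd_det_adjacency_mat_iff:
  assumes "enumerates vs (pverts G)"
  shows "odd (det (adjacency_mat G vs)) \<longleftrightarrow>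
    odd (card {p. p permutes pverts G \<and> (\<forall>v\<in>pverts G. (v, p v) \<in> parcs G)})"
proof -
  define n where "n = length vs"
  define V where "V = pverts G"
  define A where "A = adjacency_mat G vs"
  define good where "good q \<longleftrightarrow> (\<forall>i<n. (vs ! i, vs ! q i) \<in> parcs G)" for q
  have bij: "bij_betw ((!) vs) {0..<n} V"
    using assms bij_betw_nth[of vs "{0..<n}" V]
    by (auto simp: enumerates_def n_def V_def atLeast0LessThan)
  have A: "A \<in> carrier_mat n n" by (simp add: A_def adjacency_mat_def n_def)
  have entry: "A $$ (i, q i) = (if (vs ! i, vs ! q i) \<in> parcs G then 1 else 0)"
    if "q permutes {0..<n}" "i < n" for q i
    using that permutes_in_image[OF that(1), of i]
    by (simp add: A_def adjacency_mat_def n_def)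
  have "odd (signof q * (\<Prod>i = 0..<n. A $$ (i, q i))) \<longleftrightarrow> good q" if "q permutes {0..<n}" for q
    using that by (auto simp: good_def sign_def even_prod_iff entry)
  then have "{q \<in> {q. q permutes {0..<n}}. odd (signof q * (\<Prod>i = 0..<n. A $$ (i, q i)))}
      = {q \<in> {q. q permutes {0..<n}}. good q}"
    by blast
  then have "odd (det A) \<longleftrightarrow> odd (card {q \<in> {q. q permutes {0..<n}}. good q})"
    by (simp add: det_def'[OF A] even_sum_iff finite_permutations)
  moreover
  let ?\<Phi> = "\<lambda>\<pi> x. if x \<in> V then vs ! \<pi> (inv_into {0..<n} ((!) vs) x) else x"
  have "bij_betw ?\<Phi> {q \<in> {q. q permutes {0..<n}}. good q}
      {p \<in> {p. p permutes V}. \<forall>v\<in>V. (v, p v) \<in> parcs G}"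
  proof (rule bij_betw_Collect[OF bij_betw_permutations[OF bij]])
    fix q assume "q \<in> {q. q permutes {0..<n}}"
    have V: "V = (!) vs ` {0..<n}" using bij by (simp add: bij_betw_def)
    have "inv_into {0..<n} ((!) vs) (vs ! i) = i" if "i < n" for i
      using bij that by (simp add: bij_betw_def inv_into_f_f)
    then show "(\<forall>v\<in>V. (v, ?\<Phi> q v) \<in> parcs G) \<longleftrightarrow> good q"
      by (auto simp: good_def V)
  qed
  then have "card {q \<in> {q. q permutes {0..<n}}. good q}
      = card {p \<in> {p. p permutes V}. \<forall>v\<in>V. (v, p v) \<in> parcs G}"
    by (rule bij_betw_same_card)
  ultimately show ?thesis by (simp add: A_def V_def)
qed

text \<open>
  A perfect matching, encoded by the map that sends each vertex to its partner.  As
  \<^term>\<open>p permutes pverts G\<close> fixes every point outside the vertex set, a matching has only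
  one such map, so matchings can be counted through their maps.
\<close>
definition matching_involution :: "'a pair_pre_digraph \<Rightarrow> ('a \<Rightarrow> 'a) \<Rightarrow> bool" where
  "matching_involution G p \<longleftrightarrow>
     p permutes pverts G \<and> (\<forall>v\<in>pverts G. (v, p v) \<in> parcs G) \<and> (\<forall>v. p (p v) = v)"

text \<open>
  Inversion preserves the set of permutations that follow edges, because adjacency is symmetric.
  The permutations that are not involutions fall into pairs, which leaves the parity unchanged.
\<close>
lemma odd_card_matching_involutions:
  assumes "pair_graph G" "unimodular G"
  shows "odd (card {p. matching_involution G p})"
proof -
  interpret pair_graph G by fact
  let ?S = "{p. p permutes pverts G \<and> (\<forall>v\<in>pverts G. (v, p v) \<in> parcs G)}"
  obtain vs where vs: "enumerates vs (pverts G)" "det (adjacency_mat G vs) \<in> {-1, 1}"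
    using assms(2) by (auto simp: unimodular_def)
  have "odd (card ?S)"
    using vs odd_det_adjacency_mat_iff[OF vs(1)] by auto
  moreover have "even (card ?S) \<longleftrightarrow> even (card {p \<in> ?S. inv_into UNIV p = p})"
  proof (rule even_card_iff_even_card_fixpoints)
    show "finite ?S"
      using finite_permutations[OF pair_finite_verts] by (rule rev_finite_subset) auto
    fix p assume p: "p \<in> ?S"
    then show "inv_into UNIV (inv_into UNIV p) = p"
      using permutes_inv_inv by blast
    have "(v, inv_into UNIV p v) \<in> parcs G" if "v \<in> pverts G" for v
    proof -
      have "inv_into UNIV p v \<in> pverts G"
        using p that permutes_in_image[OF permutes_inv] by fastforce
      then have "(inv_into UNIV p v, v) \<in> parcs G"
        using p permutes_inverses(1)[of p "pverts G" v] by fastforce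
      then show ?thesis by (rule arcs_symmetric)
    qed
    then show "inv_into UNIV p \<in> ?S"
      using p permutes_inv by blast
  qed
  moreover have "{p \<in> ?S. inv_into UNIV p = p} = {p. matching_involution G p}"
  proof -
    have "inv_into UNIV p = p \<longleftrightarrow> (\<forall>v. p (p v) = v)" if "p permutes pverts G" for p
      by (metis that permutes_inverses(1) permutes_inv_eq ext)
    then show ?thesis by (auto simp: matching_involution_def)
  qed
  ultimately show ?thesis by simp
qed

section \<open>Alternating cycles\<close>

primrec alternate :: "('a \<Rightarrow> 'a) \<Rightarrow> ('a \<Rightarrow> 'a) \<Rightarrow> 'a \<Rightarrow> nat \<Rightarrow> 'a" where
  "alternate \<sigma> \<tau> v 0 = v"
| "alternate \<sigma> \<tau> v (Suc n) = (if even n then \<sigma> else \<tau>) (alternate \<sigma> \<tau> v n)"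

definition alternating_edges :: "('a \<Rightarrow> 'a) \<Rightarrow> ('a \<Rightarrow> 'a) \<Rightarrow> 'a set \<Rightarrow> 'a set set" where
  "alternating_edges \<sigma> \<tau> W = (\<Union>x\<in>W. {{x, \<sigma> x}, {x, \<tau> x}})"

text \<open>
  The form in which cycles are produced below: a sequence of vertices instead of a list of arcs.
\<close>
lemma ucycle_closed_sequence:
  assumes "pair_graph G" and "3 \<le> n" and closed: "f n = f 0" and "inj_on f {..<n}"
    and arcs: "\<And>i. i < n \<Longrightarrow> (f i, f (Suc i)) \<in> parcs G"
  shows "ucycle G (map (\<lambda>i. (f i, f (Suc i))) [0..<n])"
proof -
  interpret pair_graph G by fact
  let ?p = "map (\<lambda>i. (f i, f (Suc i))) [0..<n]"
  have cas: "pcas (f 0) (map (\<lambda>i. (f i, f (Suc i))) [0..<k]) (f k)" for f :: "nat \<Rightarrow> 'a" and k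
  proof (induction k arbitrary: f)
    case (Suc k)
    then show ?case
      using Suc.IH[of "\<lambda>i. f (Suc i)"]
      by (simp add: upt_conv_Cons map_Suc_upt[symmetric] comp_def del: upt_Suc)
  qed simp
  have walk: "awalk (f 0) ?p (f 0)"
    using cas[of f n] arcs in_arcsD1[OF arcs, of 0] assms(2) closed
    by (auto simp: awalk_def)
  have "pawalk_verts (f 0) ?p = fst (hd ?p) # map snd ?p"
    using awalk_verts_conv'[of "f 0" ?p "f n"] cas[of f n] assms(2) by simp
  then have tl: "tl (pawalk_verts (f 0) ?p) = map (\<lambda>i. f (Suc i)) [0..<n]"
    by (simp add: comp_def)
  have "inj_on (\<lambda>i. f (Suc i)) {..<n}"
  proof (rule inj_onI)
    fix i j assume ij: "i \<in> {..<n}" "j \<in> {..<n}" and eq: "f (Suc i) = f (Suc j)"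
    \<comment> \<open>The index \<^term>\<open>Suc i\<close> reduced to the range where \<^term>\<open>f\<close> is injective.\<close>
    define r where "r k = (if Suc k = n then 0 else Suc k)" for k
    have "f (r i) = f (r j)" using eq closed by (auto simp: r_def)
    moreover have "r i < n" "r j < n" using ij by (auto simp: r_def)
    ultimately have "r i = r j" using assms(4) by (auto dest: inj_onD)
    then show "i = j" by (auto simp: r_def split: if_splits)
  qed
  then have "distinct (tl (pawalk_verts (f 0) ?p))"
    unfolding tl by (simp add: distinct_map atLeast0LessThan)
  then have "cycle ?p"
    using walk assms(2) unfolding cycle_def by auto
  then show ?thesis using assms(2) by (simp add: ucycle_def)
qed

text \<open>
  The cycle is traced by following \<^term>\<open>\<sigma>\<close> and \<^term>\<open>\<tau>\<close> in turn from \<^term>\<open>v\<close>.  Each step can be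
  undone, so the first repeated vertex is \<^term>\<open>v\<close> itself, and it is reached after an even number
  of steps: a return of odd length would be traversed from both ends by the same steps, and its
  two ends would meet in an edge that joins a vertex to itself.
\<close>
lemma alternating_cycle:
  assumes G: "pair_graph G"
    and \<sigma>: "matching_involution G \<sigma>" and \<tau>: "matching_involution G \<tau>"
    and v: "v \<in> pverts G" "\<sigma> v \<noteq> \<tau> v"
  obtains W where "v \<in> W" "W \<subseteq> pverts G" "\<sigma> ` W \<subseteq> W" "\<tau> ` W \<subseteq> W"
    "\<forall>x\<in>W. \<sigma> x \<noteq> \<tau> x" "alternating_edges \<sigma> \<tau> W \<in> cycles G"
proof -
  interpret pair_graph G by (rule G)
  have involutions [simp]: "\<sigma> (\<sigma> x) = x" "\<tau> (\<tau> x) = x" for x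
    using \<sigma> \<tau> by (auto simp: matching_involution_def)
  have involution_eq_iff: "\<sigma> x = \<sigma> y \<longleftrightarrow> x = y" "\<tau> x = \<tau> y \<longleftrightarrow> x = y" for x y
    by (metis involutions(1), metis involutions(2))
  have involution_arcs: "(x, \<sigma> x) \<in> parcs G" "(x, \<tau> x) \<in> parcs G" if "x \<in> pverts G" for x
    using that \<sigma> \<tau> by (auto simp: matching_involution_def)
  define f where "f = alternate \<sigma> \<tau> v"
  have f0: "f 0 = v" and fSuc: "f (Suc i) = (if even i then \<sigma> (f i) else \<tau> (f i))" for i
    by (auto simp: f_def)
  have undo: "f i = (if even i then \<sigma> (f (Suc i)) else \<tau> (f (Suc i)))" for i
    by (simp add: fSuc)
  have in_V: "f i \<in> pverts G" for i
    using v(1) by (induction i) (auto simp: f0 fSuc dest: involution_arcs intro: in_arcsD2)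
  have arc: "(f i, f (Suc i)) \<in> parcs G" for i
    using in_V[of i] involution_arcs by (simp add: fSuc)
  have differ: "\<sigma> (f i) \<noteq> \<tau> (f i)" for i
  proof (induction i)
    case (Suc i)
    then show ?case by (auto simp: fSuc) (metis involutions)+
  qed (simp add: f0 v(2))
  \<comment> \<open>Indices at odd distance: one step forward at the left end and one step back at the right end
      apply the same involution, so equal ends stay equal while the distance drops by 2.\<close>
  have odd_ne: "f i \<noteq> f (i + (2 * k + 1))" for i k
  proof (induction k arbitrary: i)
    case 0
    then show ?case using arc[of i] no_loops'[of "f i" "f (Suc i)"] by simp
  next
    case (Suc k)
    show ?case
    proof
      assume eq: "f i = f (i + (2 * Suc k + 1))"
      have "f (Suc i) = f (Suc i + (2 * k + 1))"
        using fSuc[of i] undo[of "Suc i + (2 * k + 1)"] eq by (auto split: if_splits)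
      then show False using Suc.IH by blast
    qed
  qed
  have shift: "f d = f 0" if "f (i + d) = f i" "even d" for i d
    using that(1)
  proof (induction i)
    case (Suc i)
    then show ?case using that(2) by (auto simp: fSuc involution_eq_iff split: if_splits)
  qed simp
  have return: "f (j - i) = f 0 \<and> even (j - i)" if "f i = f j" "i < j" for i j
  proof -
    have "even (j - i)"
    proof (rule ccontr)
      assume "odd (j - i)"
      then obtain k where "j - i = 2 * k + 1" by (rule oddE)
      then have "j = i + (2 * k + 1)" using that(2) by simp
      then show False using odd_ne that(1) by blast
    qed
    then show ?thesis using shift[of i "j - i"] that by simp
  qed
  have "\<not> inj f"
    using in_V finite_subset[OF _ pair_finite_verts, of "range f"] range_inj_infinite[of f] by blast
  then have "\<exists>d>0. f d = f 0"
    using return by (metis injI linorder_neqE_nat zero_less_diff)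
  define n where "n = (LEAST d. d > 0 \<and> f d = f 0)"
  have n: "n > 0" "f n = f 0"
    using LeastI_ex[OF \<open>\<exists>d>0. f d = f 0\<close>] by (auto simp: n_def)
  have least: "n \<le> d" if "d > 0" "f d = f 0" for d
    unfolding n_def using that by (intro Least_le) simp
  have "even n" using return[of 0 n] n by simp
  have inj: "inj_on f {..<n}"
  proof (rule linorder_inj_onI)
    fix i j assume "i < j" "i \<in> {..<n}" "j \<in> {..<n}"
    then show "f i \<noteq> f j" using return[of i j] least[of "j - i"] by auto
  qed (rule linear)
  have "f 2 \<noteq> f 0"
    using v(2) by (auto simp: numeral_2_eq_2 fSuc f0) (metis involutions)
  then have "3 \<le> n"
    using n \<open>even n\<close> by (cases "n = 2") (auto elim!: evenE)
  define W where "W = f ` {..<n}"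
  have step: "f (Suc i) \<in> W" if "i < n" for i
    using that n by (cases "Suc i = n") (auto simp: W_def)
  \<comment> \<open>For index 0 the predecessor on the cycle is the last index \<^term>\<open>n - 1\<close>, which is odd.\<close>
  have step_back: "\<exists>j<n. odd j \<and> f i = \<tau> (f j)" if "i < n" "even i" for i
  proof (cases i)
    case 0
    have "odd (n - 1)" using \<open>even n\<close> n(1) by simp
    moreover have "f 0 = \<tau> (f (n - 1))"
      using fSuc[of "n - 1"] n calculation by simp
    ultimately show ?thesis using 0 n(1) by (intro exI[of _ "n - 1"]) simp
  next
    case (Suc k)
    then show ?thesis using that fSuc[of k] by (intro exI[of _ k]) simp
  qed
  have \<sigma>_edge: "{f i, \<sigma> (f i)} \<in> (\<lambda>i. {f i, f (Suc i)}) ` {..<n} \<and> \<sigma> (f i) \<in> W" if "i < n" for i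
  proof (cases "even i")
    case True
    then have "\<sigma> (f i) = f (Suc i)" by (simp add: fSuc)
    then show ?thesis using that step[of i] by auto
  next
    case False
    then obtain k where k: "i = Suc k" "even k" by (cases i) auto
    then have "\<sigma> (f i) = f k" by (simp add: fSuc)
    then show ?thesis using that k by (auto simp: W_def insert_commute)
  qed
  have \<tau>_edge: "{f i, \<tau> (f i)} \<in> (\<lambda>i. {f i, f (Suc i)}) ` {..<n} \<and> \<tau> (f i) \<in> W" if "i < n" for i
  proof (cases "even i")
    case False
    then have "\<tau> (f i) = f (Suc i)" by (simp add: fSuc)
    then show ?thesis using that step[of i] by auto
  next
    case True
    then obtain j where j: "j < n" "odd j" "f i = \<tau> (f j)" using step_back \<open>i < n\<close> by blast
    then have "f i = f (Suc j)" "\<tau> (f i) = f j" by (simp_all add: fSuc)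
    then show ?thesis using j(1) by (auto simp: W_def insert_commute)
  qed
  have "(\<lambda>i. {f i, f (Suc i)}) ` {..<n} \<subseteq> alternating_edges \<sigma> \<tau> W"
    by (auto simp: alternating_edges_def W_def fSuc)
  moreover have "alternating_edges \<sigma> \<tau> W \<subseteq> (\<lambda>i. {f i, f (Suc i)}) ` {..<n}"
    unfolding alternating_edges_def using \<sigma>_edge \<tau>_edge by (auto simp: W_def simp del: fSuc)
  moreover have "ucycle G (map (\<lambda>i. (f i, f (Suc i))) [0..<n])"
    using ucycle_closed_sequence[OF G \<open>3 \<le> n\<close> n(2) inj arc] .
  then have "uedge ` set (map (\<lambda>i. (f i, f (Suc i))) [0..<n]) \<in> cycles G"
    unfolding cycles_def by blast
  then have "(\<lambda>i. {f i, f (Suc i)}) ` {..<n} \<in> cycles G"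
    by (simp add: image_image uedge_def atLeast0LessThan)
  ultimately have "alternating_edges \<sigma> \<tau> W \<in> cycles G" by simp
  moreover have "v \<in> W" using n(1) f0 by (auto simp: W_def intro!: rev_image_eqI[of 0])
  moreover have "\<sigma> ` W \<subseteq> W" "\<tau> ` W \<subseteq> W" using \<sigma>_edge \<tau>_edge by (auto simp: W_def)
  moreover have "\<forall>x\<in>W. \<sigma> x \<noteq> \<tau> x" "W \<subseteq> pverts G" using differ in_V by (auto simp: W_def)
  ultimately show ?thesis by (intro that)
qed

section \<open>Perfect matchings when cycles are edge-disjoint\<close>

text \<open>
  If \<^term>\<open>\<rho>\<close> differs from \<^term>\<open>\<sigma>\<close> at a vertex of \<^term>\<open>W\<close>, the edge of \<^term>\<open>\<sigma>\<close> there lies on a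
  cycle alternating between \<^term>\<open>\<rho>\<close> and \<^term>\<open>\<sigma>\<close>.  This cycle must be the given one, whose edges
  outside \<^term>\<open>\<sigma>\<close> are those of \<^term>\<open>\<tau>\<close>.
\<close>
lemma matching_involution_agrees_on_cycle:
  assumes G: "pair_graph G"
    and disjoint: "\<forall>C\<in>cycles G. \<forall>D\<in>cycles G. C \<noteq> D \<longrightarrow> C \<inter> D = {}"
    and \<sigma>: "matching_involution G \<sigma>" and \<tau>: "matching_involution G \<tau>"
    and \<rho>: "matching_involution G \<rho>"
    and W: "W \<subseteq> pverts G" "\<forall>x\<in>W. \<sigma> x \<noteq> \<tau> x" "alternating_edges \<sigma> \<tau> W \<in> cycles G"
  shows "(\<forall>x\<in>W. \<rho> x = \<tau> x) \<or> (\<forall>x\<in>W. \<rho> x = \<sigma> x)"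
proof (rule disjCI)
  assume "\<not> (\<forall>x\<in>W. \<rho> x = \<sigma> x)"
  then obtain v where v: "v \<in> W" "\<rho> v \<noteq> \<sigma> v" by blast
  have "v \<in> pverts G" using v(1) W(1) by blast
  then obtain U where U: "v \<in> U" "alternating_edges \<rho> \<sigma> U \<in> cycles G"
    by (rule alternating_cycle[OF G \<rho> \<sigma> _ v(2)])
  have "{v, \<sigma> v} \<in> alternating_edges \<sigma> \<tau> W \<inter> alternating_edges \<rho> \<sigma> U"
    using v(1) U(1) by (auto simp: alternating_edges_def)
  then have eq: "alternating_edges \<sigma> \<tau> W = alternating_edges \<rho> \<sigma> U"
    using disjoint[rule_format, OF W(3) U(2)] by blast
  show "\<forall>x\<in>W. \<rho> x = \<tau> x"
  proof
    fix x assume x: "x \<in> W"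
    then have "{x, \<tau> x} \<in> alternating_edges \<rho> \<sigma> U"
      unfolding eq[symmetric] by (auto simp: alternating_edges_def)
    then obtain y where "{x, \<tau> x} = {y, \<rho> y} \<or> {x, \<tau> x} = {y, \<sigma> y}"
      by (auto simp: alternating_edges_def)
    then have "\<tau> x = \<rho> x \<or> \<tau> x = \<sigma> x"
      using \<rho> \<sigma> by (auto simp: doubleton_eq_iff matching_involution_def)
    then show "\<rho> x = \<tau> x" using x W(2) by auto
  qed
qed

lemma matching_involutionI:
  assumes "pair_graph G" "\<And>v. v \<in> pverts G \<Longrightarrow> (v, p v) \<in> parcs G"
    "\<And>v. v \<notin> pverts G \<Longrightarrow> p v = v" "\<And>v. p (p v) = v"
  shows "matching_involution G p"
  unfolding matching_involution_def permutes_def using assms by metis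

text \<open>
  Exchanging \<^term>\<open>\<sigma>\<close> and \<^term>\<open>\<tau>\<close> on the vertices of one of their alternating cycles is an
  involution on all matchings, and it has no fixed point.
\<close>
lemma even_card_matching_involutions:
  assumes G: "pair_graph G"
    and disjoint: "\<forall>C\<in>cycles G. \<forall>D\<in>cycles G. C \<noteq> D \<longrightarrow> C \<inter> D = {}"
    and \<sigma>: "matching_involution G \<sigma>" and \<tau>: "matching_involution G \<tau>" and "\<sigma> \<noteq> \<tau>"
  shows "even (card {p. matching_involution G p})"
proof -
  interpret pair_graph G by fact
  have inv: "\<rho> (\<rho> x) = x" "x \<notin> pverts G \<Longrightarrow> \<rho> x = x" "x \<in> pverts G \<Longrightarrow> (x, \<rho> x) \<in> parcs G"
    if "matching_involution G \<rho>" for \<rho> x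
    using that by (auto simp: matching_involution_def permutes_def)
  obtain v where "\<sigma> v \<noteq> \<tau> v" using \<open>\<sigma> \<noteq> \<tau>\<close> by blast
  then have "v \<in> pverts G" using inv(2)[OF \<sigma>] inv(2)[OF \<tau>] by metis
  obtain W where W: "v \<in> W" "W \<subseteq> pverts G" "\<sigma> ` W \<subseteq> W" "\<tau> ` W \<subseteq> W"
      "\<forall>x\<in>W. \<sigma> x \<noteq> \<tau> x" "alternating_edges \<sigma> \<tau> W \<in> cycles G"
    using alternating_cycle[OF G \<sigma> \<tau> \<open>v \<in> pverts G\<close> \<open>\<sigma> v \<noteq> \<tau> v\<close>] by blast
  \<comment> \<open>A matching agrees with only one of \<^term>\<open>\<sigma>\<close> and \<^term>\<open>\<tau>\<close> on \<^term>\<open>W\<close>, and its value at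
      \<^term>\<open>v\<close> tells which one.\<close>
  define swap where
    "swap \<rho> x = (if x \<notin> W then \<rho> x else if \<rho> v = \<sigma> v then \<tau> x else \<sigma> x)" for \<rho> x
  let ?S = "{p. matching_involution G p}"
  have cases: "(\<rho> v = \<sigma> v \<and> (\<forall>x\<in>W. \<rho> x = \<sigma> x)) \<or> (\<rho> v \<noteq> \<sigma> v \<and> (\<forall>x\<in>W. \<rho> x = \<tau> x))"
    if "matching_involution G \<rho>" for \<rho>
    using matching_involution_agrees_on_cycle[OF G disjoint \<sigma> \<tau> that W(2,5,6)] W(1,5) by metis
  have "even (card ?S) \<longleftrightarrow> even (card {p \<in> ?S. swap p = p})"
  proof (rule even_card_iff_even_card_fixpoints)
    have "?S \<subseteq> {p. p permutes pverts G}" by (auto simp: matching_involution_def)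
    then show "finite ?S"
      using finite_permutations[OF pair_finite_verts] by (rule finite_subset)
    fix \<rho> assume "\<rho> \<in> ?S"
    then have \<rho>: "matching_involution G \<rho>" by simp
    have out: "\<rho> x \<notin> W" if "x \<notin> W" for x
    proof
      assume "\<rho> x \<in> W"
      then have "\<rho> (\<rho> x) \<in> W" using cases[OF \<rho>] W(3,4) by auto
      then show False using that inv(1)[OF \<rho>] by simp
    qed
    have "matching_involution G (swap \<rho>)"
    proof (rule matching_involutionI[OF G])
      show "(x, swap \<rho> x) \<in> parcs G" if "x \<in> pverts G" for x
        using that inv(3) \<sigma> \<tau> \<rho> by (simp add: swap_def)
      show "swap \<rho> x = x" if "x \<notin> pverts G" for x
        using that inv(2)[OF \<rho>] W(2) by (auto simp: swap_def)
      show "swap \<rho> (swap \<rho> x) = x" for x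
        using out[of x] W(3,4) inv(1) \<sigma> \<tau> \<rho> by (auto simp: swap_def)
    qed
    then show "swap \<rho> \<in> ?S" by simp
    show "swap (swap \<rho>) = \<rho>"
      using cases[OF \<rho>] W(1,5) by (auto simp: swap_def fun_eq_iff)
  qed
  moreover have "{p \<in> ?S. swap p = p} = {}"
  proof -
    have "swap \<rho> v \<noteq> \<rho> v" if "matching_involution G \<rho>" for \<rho>
      using cases[OF that] W(1,5) by (auto simp: swap_def)
    then have "swap \<rho> \<noteq> \<rho>" if "matching_involution G \<rho>" for \<rho>
      using that by metis
    then show ?thesis by blast
  qed
  ultimately show ?thesis by (metis card.empty even_zero)
qed

section \<open>Perfect matchings as involutions\<close>

definition matching_graph :: "'a pair_pre_digraph \<Rightarrow> ('a \<Rightarrow> 'a) \<Rightarrow> 'a pair_pre_digraph" where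
  "matching_graph G p = \<lparr>pverts = pverts G, parcs = (\<lambda>v. (v, p v)) ` pverts G\<rparr>"

lemma perfect_matching_matching_graph:
  assumes "pair_graph G" and p: "matching_involution G p"
  shows "perfect_matching (matching_graph G p) G"
proof -
  interpret pair_graph G by fact
  let ?M = "matching_graph G p"
  have inv: "p (p x) = x" "x \<in> pverts G \<Longrightarrow> p x \<in> pverts G" "x \<in> pverts G \<Longrightarrow> (x, p x) \<in> parcs G" for x
    using p by (auto simp: matching_involution_def permutes_in_image)
  have ne: "p x \<noteq> x" if "x \<in> pverts G" for x
    using inv(3)[OF that] no_loops' by fastforce
  interpret M: pair_graph ?M
  proof
    show "symmetric (with_proj ?M)"
      unfolding symmetric_def matching_graph_def
      by (rule symI) (auto simp: inv intro!: image_eqI)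
  qed (auto simp: matching_graph_def inv ne[symmetric] pair_finite_verts)
  have reach: "w \<in> {u, p u}" if "u \<rightarrow>\<^sup>*\<^bsub>with_proj ?M\<^esub> w" for u w
    using that by (induction rule: M.reachable_induct) (auto simp: matching_graph_def inv)
  have "K\<^bsub>2\<^esub> C" if C: "C \<in> M.sccs" for C
  proof -
    obtain S where S: "S \<in> M.sccs_verts" "C = induce_subgraph (with_proj ?M) S"
      using C unfolding M.sccs_conv_sccs_verts by blast
    have S': "S \<noteq> {}" "\<And>u v. u \<in> S \<Longrightarrow> v \<in> S \<Longrightarrow> u \<rightarrow>\<^sup>*\<^bsub>with_proj ?M\<^esub> v"
        "\<And>u v. u \<in> S \<Longrightarrow> u \<rightarrow>\<^sup>*\<^bsub>with_proj ?M\<^esub> v \<Longrightarrow> v \<rightarrow>\<^sup>*\<^bsub>with_proj ?M\<^esub> u \<Longrightarrow> v \<in> S"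
      using S(1) unfolding M.in_sccs_verts_conv_reachable by blast+
    obtain u where u: "u \<in> S" using S'(1) by blast
    have uV: "u \<in> pverts G"
      using M.reachable_in_verts(1)[OF S'(2)[OF u u]] by (simp add: matching_graph_def)
    have arcs: "(u, p u) \<in> parcs ?M" "(p u, u) \<in> parcs ?M"
      using uV inv by (auto simp: matching_graph_def intro!: image_eqI)
    have "S = {u, p u}"
      using S'(3)[OF u] M.reachable_adjI[of u "p u"] M.reachable_adjI[of "p u" u]
        arcs reach S'(2)[OF u] u by auto
    moreover have "C = with_proj \<lparr>pverts = S,
        parcs = {e \<in> parcs ?M. fst e \<in> S \<and> snd e \<in> S}\<rparr>"
      unfolding S(2) by (simp add: induce_subgraph_def with_proj_def)
    ultimately show ?thesis
      using uV ne[OF uV] arcs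
      by (auto simp: complete_digraph_pair_def matching_graph_def inv(1) intro!: image_eqI)
  qed
  moreover have "spanning (with_proj ?M) (with_proj G)"
    unfolding spanning_def subgraph_def
    using inv(3) M.wf_digraph_axioms wf_digraph_axioms by (auto simp: matching_graph_def)
  ultimately show ?thesis
    unfolding perfect_matching_def using M.pair_graph by blast
qed

text \<open>
  The component of \<^term>\<open>v\<close> contains all neighbours of \<^term>\<open>v\<close>, and it is a \<open>K\<^sub>2\<close>.
\<close>
lemma perfect_matching_unique_neighbour:
  assumes "perfect_matching M G" "v \<in> pverts M"
  shows "\<exists>!w. (v, w) \<in> parcs M"
proof -
  interpret M: pair_graph M using assms(1) by (simp add: perfect_matching_def)
  define S where "S = M.scc_of v"
  have S: "S \<in> M.sccs_verts"
    unfolding S_def using assms(2) by (simp add: M.scc_of_in_sccs_verts)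
  let ?C = "induce_subgraph (with_proj M) S"
  have "?C \<in> M.sccs"
    using S unfolding M.sccs_conv_sccs_verts by blast
  then have K2: "K\<^bsub>2\<^esub> ?C" using assms(1) by (simp add: perfect_matching_def)
  have eq: "?C = with_proj \<lparr>pverts = S, parcs = {e \<in> parcs M. fst e \<in> S \<and> snd e \<in> S}\<rparr>"
    by (simp add: induce_subgraph_def with_proj_def)
  have card: "card S = 2"
    and arcs: "{e \<in> parcs M. fst e \<in> S \<and> snd e \<in> S} = {(u,w). u \<in> S \<and> w \<in> S \<and> u \<noteq> w}"
    using K2 unfolding eq complete_digraph_pair_def by auto
  have "v \<in> S" unfolding S_def using assms(2) by (simp add: M.in_scc_of_self)
  have nb: "w \<in> S" if "(v, w) \<in> parcs M" for w
    using that M.arcs_symmetric[OF that] M.reachable_adjI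
    unfolding S_def M.scc_of_def by auto
  have "(v, w) \<in> parcs M \<longleftrightarrow> w \<in> S \<and> w \<noteq> v" for w
    using nb[of w] \<open>v \<in> S\<close> arcs M.no_loops'[of v w] by auto
  moreover obtain a b where "S = {a, b}" "a \<noteq> b"
    using card by (auto simp: card_2_iff)
  ultimately show ?thesis using \<open>v \<in> S\<close> by auto
qed

lemma perfect_matching_eq_matching_graph:
  assumes "pair_graph G" and M: "perfect_matching M G"
  obtains p where "matching_involution G p" "M = matching_graph G p"
proof -
  interpret M: pair_graph M using M by (simp add: perfect_matching_def)
  have verts: "pverts M = pverts G" and sub: "parcs M \<subseteq> parcs G"
    using M by (auto simp: perfect_matching_def spanning_def subgraph_def)
  define p where "p v = (if v \<in> pverts G then THE w. (v, w) \<in> parcs M else v)" for v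
  have arc: "(v, w) \<in> parcs M \<longleftrightarrow> w = p v" if "v \<in> pverts G" for v w
    using perfect_matching_unique_neighbour[OF M, of v] that theI'[of "\<lambda>w. (v, w) \<in> parcs M"]
    unfolding verts p_def by auto
  have involutive: "p (p v) = v" for v
  proof (cases "v \<in> pverts G")
    case True
    then have "(p v, v) \<in> parcs M" using arc M.arcs_symmetric by blast
    then show ?thesis using arc[of "p v" v] M.in_arcsD1 verts by auto
  qed (simp add: p_def)
  have "matching_involution G p"
  proof (rule matching_involutionI[OF assms(1)])
    show "(v, p v) \<in> parcs G" if "v \<in> pverts G" for v using that arc sub by blast
    show "p v = v" if "v \<notin> pverts G" for v using that by (simp add: p_def)
  qed (rule involutive)
  moreover have "parcs M = (\<lambda>v. (v, p v)) ` pverts G"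
  proof -
    have "(v, w) \<in> parcs M \<longleftrightarrow> v \<in> pverts G \<and> w = p v" for v w
      using arc M.in_arcsD1 verts by metis
    then show ?thesis by auto
  qed
  then have "M = matching_graph G p"
    using verts by (simp add: matching_graph_def)
  ultimately show ?thesis by (rule that)
qed

section \<open>Uniqueness of the perfect matching\<close>

theorem lemma10:
  fixes B :: "'a pair_pre_digraph"
  assumes "pair_graph B"
    and "infinity_bicyclic B"
    and "unimodular B"
  shows "\<exists>!M. perfect_matching M B"
proof -
  have disjoint: "\<forall>C\<in>cycles B. \<forall>D\<in>cycles B. C \<noteq> D \<longrightarrow> C \<inter> D = {}"
    using assms(2) by (simp add: infinity_bicyclic_def)
  have odd: "odd (card {p. matching_involution B p})"
    by (rule odd_card_matching_involutions[OF assms(1,3)])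
  then have "{p. matching_involution B p} \<noteq> {}" by (metis card.empty even_zero)
  then obtain p where p: "matching_involution B p" by blast
  have unique: "q = p" if "matching_involution B q" for q
    using even_card_matching_involutions[OF assms(1) disjoint that p] odd by blast
  show ?thesis
  proof (rule ex1I)
    show "perfect_matching (matching_graph B p) B"
      by (rule perfect_matching_matching_graph[OF assms(1) p])
    show "M = matching_graph B p" if "perfect_matching M B" for M
      using perfect_matching_eq_matching_graph[OF assms(1) that] unique by metis
  qed
qed

end
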